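(* Let $D\subset\mathbb C^3$ be a bounded quasi-circular domain containing the origin, with weight $(m_1,m_2,m_3)$ such that $3\le m_1<m_2<m_3<2m_1$. Then every holomorphic automorphism $f$ of $D$ with $f(0)=0$ is linear, i.e. is the restriction to $D$ of a $\mathbb C$-linear map $\mathbb C^3\to\mathbb C^3$.
   Context: A weight is a triple of positive integers $(m_1,m_2,m_3)$ with $\gcd(m_1,m_2,m_3)=1$. A domain (connected open set) $D\subset\mathbb C^3$ is quasi-circular with weight $(m_1,m_2,m_3)$ if for every $\theta\in\mathbb R$ it is invariant under the map $(z_1,z_2,z_3)\mapsto(e^{im_1\theta}z_1,e^{im_2\theta}z_2,e^{im_3\theta}z_3)$. A holomorphic automorphism of $D$ is a biholomorphic map $D\to D$. *)

theory Defs
  imports "HOL-Analysis.Analysis"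
begin

text \<open>Complex linearity of maps between the spaces $\mathbb{C}^n$. The constant
  \<^const>\<open>linear\<close> means real linearity, so we use the vector space structure given by
  the componentwise scaling \<open>(*s)\<close> over the field of complex numbers.\<close>

abbreviation complex_linear :: "(complex^'n \<Rightarrow> complex^'m) \<Rightarrow> bool" where
  "complex_linear \<equiv> Vector_Spaces.linear (*s) (*s)"

text \<open>Holomorphy in several variables, meant for open \<open>D\<close>: the (real) Frechet derivative
  exists and is complex linear at every point of \<open>D\<close>.\<close>

definition holomorphic_map_on :: "(complex^'n \<Rightarrow> complex^'m) \<Rightarrow> (complex^'n) set \<Rightarrow> bool" where
  "holomorphic_map_on f D \<longleftrightarrow>
     (\<forall>z\<in>D. \<exists>f'. (f has_derivative f') (at z) \<and> complex_linear f')"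

definition biholomorphic_map ::
    "(complex^'n \<Rightarrow> complex^'m) \<Rightarrow> (complex^'n) set \<Rightarrow> (complex^'m) set \<Rightarrow> bool" where
  "biholomorphic_map f D E \<longleftrightarrow>
     bij_betw f D E \<and> holomorphic_map_on f D \<and> holomorphic_map_on (inv_into D f) E"

definition holomorphic_automorphism :: "(complex^'n \<Rightarrow> complex^'n) \<Rightarrow> (complex^'n) set \<Rightarrow> bool" where
  "holomorphic_automorphism f D \<longleftrightarrow> biholomorphic_map f D D"

definition is_domain :: "(complex^'n) set \<Rightarrow> bool" where
  "is_domain D \<longleftrightarrow> open D \<and> connected D \<and> D \<noteq> {}"

definition is_weight :: "nat \<Rightarrow> nat \<Rightarrow> nat \<Rightarrow> bool" where
  "is_weight m1 m2 m3 \<longleftrightarrow> 0 < m1 \<and> 0 < m2 \<and> 0 < m3 \<and> gcd m1 (gcd m2 m3) = 1"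

definition weighted_rotation :: "nat \<Rightarrow> nat \<Rightarrow> nat \<Rightarrow> real \<Rightarrow> complex^3 \<Rightarrow> complex^3" where
  "weighted_rotation m1 m2 m3 \<theta> z =
     vector [exp (\<i> * of_nat m1 * of_real \<theta>) * z $ 1,
             exp (\<i> * of_nat m2 * of_real \<theta>) * z $ 2,
             exp (\<i> * of_nat m3 * of_real \<theta>) * z $ 3]"

definition quasi_circular_domain :: "nat \<Rightarrow> nat \<Rightarrow> nat \<Rightarrow> (complex^3) set \<Rightarrow> bool" where
  "quasi_circular_domain m1 m2 m3 D \<longleftrightarrow>
     is_weight m1 m2 m3 \<and> is_domain D \<and> (\<forall>\<theta>. weighted_rotation m1 m2 m3 \<theta> ` D = D)"

end

theory Submission
  imports Defs "HOL-Complex_Analysis.Conformal_Mappings"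
begin

text \<open>For an automorphism \<open>g\<close> fixing the origin, with derivative \<open>A\<close> there, compare
  \<open>A\<inverse> \<circ> g\<close> with the identity. Let \<open>\<rho>\<^sub>t\<close> be the weighted rotations. Since no weight is a
  sum of two or more weights, averaging \<open>\<rho>\<^sub>t\<inverse> \<circ> A \<circ> g\<inverse> \<circ> \<rho>\<^sub>t\<close> over \<open>t\<close> gives the identity near
  the origin. Evaluated at \<open>g z\<close>, this says that \<open>A\<inverse> (g z) - z\<close> is the average of the same
  expression for the automorphisms \<open>g\<inverse> \<circ> \<rho>\<^sub>t \<circ> g\<close>. These are uniformly close to the identity for
  small \<open>t\<close>, by Cauchy estimates that do not depend on \<open>g\<close>, so the supremum \<open>R\<close> of
  \<open>norm (A\<inverse> (g z) - z)\<close> over all automorphisms \<open>g\<close> and all small \<open>z\<close> satisfies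
  \<open>R \<le> R * (1 - \<eta> / 2)\<close> for some \<open>\<eta> > 0\<close>. Hence \<open>R = 0\<close>.\<close>

section \<open>Reduction of holomorphic maps to one complex variable\<close>

lemma complex_linear_scale: "complex_linear L \<Longrightarrow> L (c *s v) = c *s L v"
  by (simp add: Vector_Spaces.linear_iff)

lemma norm_vector_scale: "norm (c *s v) = norm c * norm (v :: complex^'n)"
  by (simp add: norm_vec_def L2_set_def norm_mult power_mult_distrib flip: sum_distrib_left)
     (simp add: real_sqrt_mult)

lemma has_derivative_vec:
  fixes f :: "'a::real_normed_vector \<Rightarrow> complex^'n"
  assumes "\<And>i. ((\<lambda>x. f x $ i) has_derivative (\<lambda>h. f' h $ i)) (at x within S)"
  shows "(f has_derivative f') (at x within S)"
proof (subst has_derivative_componentwise_within, safe)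
  fix b :: "complex^'n" assume "b \<in> Basis"
  then obtain i c where "b = axis i c" by (auto simp: Basis_vec_def)
  then show "((\<lambda>x. f x \<bullet> b) has_derivative (\<lambda>h. f' h \<bullet> b)) (at x within S)"
    using has_derivative_inner_left[OF assms, of i c] by (simp add: inner_axis)
qed

lemma has_integral_vec:
  fixes f :: "'a::euclidean_space \<Rightarrow> complex^'n"
  assumes "\<And>i. ((\<lambda>x. f x $ i) has_integral y $ i) S"
  shows "(f has_integral y) S"
proof (rule has_integral_componentwise)
  fix b :: "complex^'n" assume "b \<in> Basis"
  then obtain i c where "b = axis i c" by (auto simp: Basis_vec_def)
  then show "((\<lambda>x. f x \<bullet> b) has_integral (y \<bullet> b)) S"
    using has_integral_linear[OF assms[of i] bounded_linear_inner_left[of c]]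
    by (simp add: inner_axis o_def)
qed

text \<open>By complex linearity of \<open>u'\<close>, the chain rule yields the derivative
  \<open>h *s u' v\<close>, which is multiplication by a complex number in each component. This lets
  one-variable function theory act on maps of several variables.\<close>

lemma has_field_derivative_holomorphic_curve:
  fixes u :: "complex^'n \<Rightarrow> complex^'m"
  assumes "(u has_derivative u') (at (\<gamma> \<zeta>))" "complex_linear u'"
    and "\<And>i. ((\<lambda>\<zeta>. \<gamma> \<zeta> $ i) has_field_derivative v $ i) (at \<zeta>)"
  shows "((\<lambda>\<zeta>. u (\<gamma> \<zeta>) $ l) has_field_derivative u' v $ l) (at \<zeta>)"
proof -
  have "(\<gamma> has_derivative (\<lambda>h. h *s v)) (at \<zeta>)"
    using assms(3) by (intro has_derivative_vec) (auto simp: has_field_derivative_def mult_commute_abs)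
  from has_derivative_compose[OF this assms(1)]
  have "((\<lambda>\<zeta>. u (\<gamma> \<zeta>)) has_derivative (\<lambda>h. h *s u' v)) (at \<zeta>)"
    by (simp add: complex_linear_scale[OF assms(2)])
  from bounded_linear.has_derivative[OF bounded_linear_vec_nth this]
  show ?thesis
    by (simp add: has_field_derivative_def mult_commute_abs)
qed

lemma holomorphic_on_line:
  assumes "holomorphic_map_on u D" "\<And>\<zeta>. \<zeta> \<in> S \<Longrightarrow> a + \<zeta> *s v \<in> D"
  shows "(\<lambda>\<zeta>. u (a + \<zeta> *s v) $ l) holomorphic_on S"
proof -
  have "(\<lambda>\<zeta>. u (a + \<zeta> *s v) $ l) field_differentiable (at \<zeta>)" if \<zeta>: "\<zeta> \<in> S" for \<zeta>
  proof -
    obtain u' where "(u has_derivative u') (at (a + \<zeta> *s v))" "complex_linear u'"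
      using assms(1) assms(2)[OF \<zeta>] unfolding holomorphic_map_on_def by blast
    from has_field_derivative_holomorphic_curve[of u u' "\<lambda>\<zeta>. a + \<zeta> *s v", OF this, of v l]
    show ?thesis
      by (force simp: field_differentiable_def intro!: derivative_eq_intros)
  qed
  then show ?thesis
    by (auto simp: holomorphic_on_def intro: field_differentiable_at_within)
qed

section \<open>Cauchy estimates with constants independent of the map\<close>

text \<open>Cauchy's inequality on the complex line through \<open>a\<close> in direction
  \<open>v\<close>, applied to each component; summing the components produces the factor
  \<open>CARD('m)\<close>. The constant depends on \<open>u\<close> only through \<open>M\<close>,
  so it serves all automorphisms of a bounded domain at once.\<close>

lemma Cauchy_derivative_bound:
  fixes u :: "complex^'n \<Rightarrow> complex^'m" and M :: real
  assumes hol: "holomorphic_map_on u D" and sub: "cball a s \<subseteq> D" and "0 < s"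
    and bd: "\<And>x. x \<in> D \<Longrightarrow> norm (u x) \<le> M"
    and der: "(u has_derivative u') (at a)" "complex_linear u'"
  shows "norm (u' v) \<le> CARD('m) * M / s * norm v"
proof (cases "v = 0")
  case True
  then show ?thesis
    using linear_0[OF has_derivative_linear[OF der(1)]] by simp
next
  case False
  \<comment> \<open>The largest radius for which the disc \<open>a + \<zeta> *s v\<close> stays in
    \<open>cball a s\<close>.\<close>
  define R where "R = s / norm v"
  have R: "0 < R" using \<open>0 < s\<close> False by (simp add: R_def)
  have inD: "a + \<zeta> *s v \<in> D" if "norm \<zeta> \<le> R" for \<zeta>
    using that sub False by (force simp: R_def norm_vector_scale dist_norm pos_le_divide_eq)
  have "norm (u' v $ l) \<le> M / R" for l
  proof -
    define \<phi> where "\<phi> = (\<lambda>\<zeta>. u (a + \<zeta> *s v) $ l)"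
    have h: "\<phi> holomorphic_on cball 0 R"
      unfolding \<phi>_def by (rule holomorphic_on_line[OF hol]) (auto intro: inD)
    have "(\<phi> has_field_derivative u' v $ l) (at 0)"
      unfolding \<phi>_def using der
      by (intro has_field_derivative_holomorphic_curve[of u u' "\<lambda>\<zeta>. a + \<zeta> *s v"])
         (auto intro!: derivative_eq_intros)
    then have "deriv \<phi> 0 = u' v $ l" by (rule DERIV_imp_deriv)
    moreover have "norm ((deriv ^^ 1) \<phi> 0) \<le> fact 1 * M / R ^ 1"
    proof (rule Cauchy_inequality)
      show "\<phi> holomorphic_on ball 0 R" using h by (rule holomorphic_on_subset) auto
      show "continuous_on (cball 0 R) \<phi>" using h by (rule holomorphic_on_imp_continuous_on)
      show "norm (\<phi> \<zeta>) \<le> M" if "norm (0 - \<zeta>) = R" for \<zeta>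
        unfolding \<phi>_def using that inD[of \<zeta>] bd[of "a + \<zeta> *s v"]
        by (auto intro: order_trans[OF Finite_Cartesian_Product.norm_nth_le])
    qed (fact R)
    ultimately show ?thesis by simp
  qed
  then have "(\<Sum>l\<in>UNIV. norm (u' v $ l)) \<le> CARD('m) * (M / R)"
    by (rule sum_bounded_above)
  moreover have "norm (u' v) \<le> (\<Sum>l\<in>UNIV. norm (u' v $ l))"
    by (simp add: norm_vec_def L2_set_le_sum)
  ultimately show ?thesis by (simp add: R_def field_simps)
qed

text \<open>Every ball of radius \<open>s\<close> centred in \<open>cball 0 s\<close> lies in
  \<open>cball 0 (2 * s)\<close>, so the derivative bound holds on a convex set and the mean value
  inequality applies.\<close>

lemma Cauchy_Lipschitz_bound:
  fixes u :: "complex^'n \<Rightarrow> complex^'m" and M :: real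
  assumes hol: "holomorphic_map_on u D" and sub: "cball 0 (2 * s) \<subseteq> D" and "0 < s"
    and bd: "\<And>x. x \<in> D \<Longrightarrow> norm (u x) \<le> M"
    and "norm x \<le> s" "norm y \<le> s"
  shows "norm (u x - u y) \<le> CARD('m) * M / s * norm (x - y)"
proof -
  have in_ball: "cball z s \<subseteq> D" if "z \<in> cball 0 s" for z
    using that sub by (smt (verit, ccfv_threshold) cball_subset_cball_iff dist_commute
        mem_cball order_trans subset_eq dist_triangle)
  then have "z \<in> D" if "z \<in> cball 0 s" for z
    using that \<open>0 < s\<close> by force
  then obtain u' where u': "\<And>z. z \<in> cball 0 s \<Longrightarrow> (u has_derivative u' z) (at z)"
      "\<And>z. z \<in> cball 0 s \<Longrightarrow> complex_linear (u' z)"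
    using hol unfolding holomorphic_map_on_def by metis
  show ?thesis
  proof (rule differentiable_bound[of "cball 0 s"])
    show "onorm (u' z) \<le> CARD('m) * M / s" if "z \<in> cball 0 s" for z
      using Cauchy_derivative_bound[OF hol in_ball \<open>0 < s\<close> bd u'] that
      by (intro onorm_le) auto
  qed (use assms u' in \<open>auto intro: has_derivative_at_withinI\<close>)
qed

text \<open>First-order Taylor expansion along the line through \<open>0\<close> and
  \<open>x\<close>: both Taylor terms vanish and Cauchy's inequality controls the second derivative.
  The factor 2 is \<open>fact 2\<close> from Cauchy; the remainder in \<open>complex_Taylor\<close>
  is divided only by \<open>fact 1\<close>.\<close>

lemma Cauchy_quadratic_bound:
  fixes u :: "complex^'n \<Rightarrow> complex^'m" and M :: real
  assumes hol: "holomorphic_map_on u D" and sub: "cball 0 (2 * s) \<subseteq> D" and "0 < s"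
    and bd: "\<And>x. x \<in> D \<Longrightarrow> norm (u x) \<le> M"
    and u0: "u 0 = 0" and der: "(u has_derivative (\<lambda>_. 0)) (at 0)"
    and x: "norm x \<le> s"
  shows "norm (u x $ l) \<le> 2 * M / s\<^sup>2 * (norm x)\<^sup>2"
proof (cases "x = 0")
  case True
  then show ?thesis using u0 by simp
next
  case False
  \<comment> \<open>With a unit direction, \<open>x\<close> sits at parameter \<open>norm x\<close>
    and parameters measure distance from the origin.\<close>
  define v where "v = of_real (1 / norm x) *s x"
  have v: "norm v = 1" "of_real (norm x) *s v = x"
    using False unfolding v_def by (auto simp add: norm_vector_scale norm_divide vec_eq_iff)
  define \<phi> where "\<phi> = (\<lambda>\<zeta>. u (\<zeta> *s v) $ l)"
  have inD: "\<zeta> *s v \<in> D" if "norm \<zeta> \<le> 2 * s" for \<zeta>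
    using that sub by (force simp: norm_vector_scale v)
  have h: "\<phi> holomorphic_on cball 0 (2 * s)"
    unfolding \<phi>_def using holomorphic_on_line[OF hol, of "cball 0 (2 * s)" 0 v l]
    by (auto intro: inD)
  then have hb: "\<phi> holomorphic_on ball 0 (2 * s)" by (rule holomorphic_on_subset) auto
  have bound2: "norm ((deriv ^^ 2) \<phi> \<zeta>) \<le> 2 * M / s\<^sup>2" if "\<zeta> \<in> cball 0 s" for \<zeta>
  proof -
    have "cball \<zeta> s \<subseteq> cball 0 (2 * s)"
      using that by (auto simp: cball_subset_cball_iff)
    have *: "\<phi> holomorphic_on cball \<zeta> s" "\<And>z. dist \<zeta> z \<le> s \<Longrightarrow> norm z \<le> 2 * s"
      using \<open>cball \<zeta> s \<subseteq> _\<close> by (auto intro: holomorphic_on_subset[OF h])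
    have "norm ((deriv ^^ 2) \<phi> \<zeta>) \<le> fact 2 * M / s ^ 2"
    proof (rule Cauchy_inequality)
      show "\<phi> holomorphic_on ball \<zeta> s" using *(1) by (rule holomorphic_on_subset) auto
      show "continuous_on (cball \<zeta> s) \<phi>" using *(1) by (rule holomorphic_on_imp_continuous_on)
      show "norm (\<phi> z) \<le> M" if "norm (\<zeta> - z) = s" for z
        unfolding \<phi>_def using that inD[OF *(2)[of z]] bd[of "z *s v"]
        by (auto simp: dist_norm intro: order_trans[OF Finite_Cartesian_Product.norm_nth_le])
    qed (fact \<open>0 < s\<close>)
    then show ?thesis by simp
  qed
  have "0 \<in> D" using sub \<open>0 < s\<close> by force
  then obtain u' where u': "(u has_derivative u') (at 0)" "complex_linear u'"
    using hol by (auto simp: holomorphic_map_on_def)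
  then have "u' = (\<lambda>_. 0)" using der has_derivative_unique by blast
  then have "(\<phi> has_field_derivative 0) (at 0)"
    unfolding \<phi>_def using u' 
    by (intro has_field_derivative_holomorphic_curve[of u u' "\<lambda>\<zeta>. \<zeta> *s v", where v = v, THEN DERIV_cong])
       (auto intro!: derivative_eq_intros)
  then have \<phi>0: "deriv \<phi> 0 = 0" "\<phi> 0 = 0" 
    using u0 by (auto simp: \<phi>_def intro: DERIV_imp_deriv)
  have "norm ((deriv ^^ 0) \<phi> (of_real (norm x)) -
      (\<Sum>i\<le>1. (deriv ^^ i) \<phi> 0 * (of_real (norm x) - 0) ^ i / fact i))
      \<le> (2 * M / s\<^sup>2) * norm (of_real (norm x) - 0 :: complex) ^ Suc 1 / fact 1"
  proof (rule complex_Taylor[of "cball 0 s" 1 "\<lambda>i. (deriv ^^ i) \<phi>"])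
    show "((deriv ^^ i) \<phi> has_field_derivative (deriv ^^ Suc i) \<phi> z) (at z within cball 0 s)"
      if "z \<in> cball 0 s" for z i
    proof -
      have "(deriv ^^ i) \<phi> holomorphic_on ball 0 (2 * s)"
        using hb by (rule holomorphic_higher_deriv) auto
      then show ?thesis
        using that \<open>0 < s\<close>
        by (auto intro!: holomorphic_derivI[of _ "ball 0 (2 * s)"] intro: DERIV_subset)
    qed
    show "norm ((deriv ^^ Suc 1) \<phi> z) \<le> 2 * M / s\<^sup>2" if "z \<in> cball 0 s" for z
      using bound2[OF that] by (simp add: numeral_2_eq_2)
  qed (use x \<open>0 < s\<close> in auto)
  then have "norm (\<phi> (of_real (norm x))) \<le> 2 * M / s\<^sup>2 * (norm x)\<^sup>2"
    by (simp add: \<phi>0 power2_eq_square)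
  then show ?thesis by (simp add: \<phi>_def v)
qed

section \<open>Weighted scalings\<close>

text \<open>The parameter is not restricted to the unit circle: orbits then become holomorphic in
  \<open>\<zeta>\<close> on the whole disc, and letting \<open>\<zeta>\<close> tend to 0 detects
  orders of vanishing.\<close>

definition weighted_scale :: "('n \<Rightarrow> nat) \<Rightarrow> complex \<Rightarrow> complex^'n \<Rightarrow> complex^'n" where
  "weighted_scale m \<zeta> z = (\<chi> i. \<zeta> ^ m i * z $ i)"

lemma weighted_scale_nth [simp]: "weighted_scale m \<zeta> z $ i = \<zeta> ^ m i * z $ i"
  by (simp add: weighted_scale_def)

lemma weighted_scale_one [simp]: "weighted_scale m 1 z = z"
  by (simp add: vec_eq_iff)

lemma weighted_scale_zero [simp]: "weighted_scale m \<zeta> 0 = 0"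
  by (simp add: vec_eq_iff)

lemma weighted_scale_mult:
  "weighted_scale m \<zeta> (weighted_scale m \<eta> z) = weighted_scale m (\<zeta> * \<eta>) z"
  by (simp add: vec_eq_iff power_mult_distrib)

lemma weighted_scale_inverse [simp]:
  assumes "\<zeta> \<noteq> 0"
  shows "weighted_scale m (inverse \<zeta>) (weighted_scale m \<zeta> z) = z"
    and "weighted_scale m \<zeta> (weighted_scale m (inverse \<zeta>) z) = z"
  using assms by (simp_all add: weighted_scale_mult)

lemma weighted_scale_diff:
  "weighted_scale m \<zeta> (x - y) = weighted_scale m \<zeta> x - weighted_scale m \<zeta> y"
  by (simp add: vec_eq_iff algebra_simps)

lemma complex_linear_weighted_scale: "complex_linear (weighted_scale m \<zeta>)"
  by (simp add: Vector_Spaces.linear_iff vec_eq_iff algebra_simps)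
     (unfold_locales; simp add: algebra_simps)

lemma bounded_linear_weighted_scale: "bounded_linear (weighted_scale m \<zeta>)"
  by (rule linear_conv_bounded_linear[THEN iffD1], rule linearI)
     (simp_all add: vec_eq_iff algebra_simps scaleR_conv_of_real)

lemma norm_weighted_scale [simp]:
  assumes "norm \<zeta> = 1"
  shows "norm (weighted_scale m \<zeta> z) = norm z"
  by (simp add: norm_vec_def norm_mult norm_power assms)

lemma norm_weighted_scale_le:
  fixes \<mu> :: nat
  assumes "norm \<zeta> \<le> 1" "\<And>i. \<mu> \<le> m i"
  shows "norm (weighted_scale m \<zeta> z) \<le> norm \<zeta> ^ \<mu> * norm z"
proof -
  have "norm (weighted_scale m \<zeta> z) \<le> norm ((norm \<zeta> ^ \<mu>) *\<^sub>R z)"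
    by (rule norm_le_componentwise_cart)
       (auto simp: norm_mult norm_power intro!: mult_right_mono power_decreasing assms)
  then show ?thesis by simp
qed

lemma norm_weighted_scale_diff_le:
  fixes N :: nat
  assumes "norm \<zeta> = 1" "\<And>i. m i \<le> N"
  shows "norm (weighted_scale m \<zeta> z - z) \<le> N * norm (\<zeta> - 1) * norm z"
proof -
  have *: "norm (\<zeta> ^ m i - 1) \<le> N * norm (\<zeta> - 1)" for i
  proof -
    have "norm (\<zeta> ^ m i - 1 ^ m i) \<le> m i * norm (\<zeta> - 1)"
      by (rule norm_power_diff) (simp_all add: assms)
    also have "\<dots> \<le> N * norm (\<zeta> - 1)"
      by (rule mult_right_mono) (use assms(2) in auto)
    finally show ?thesis by simp
  qed
  have "norm (weighted_scale m \<zeta> z - z) \<le> norm ((N * norm (\<zeta> - 1)) *\<^sub>R z)"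
  proof (rule norm_le_componentwise_cart)
    fix i
    have "(weighted_scale m \<zeta> z - z) $ i = (\<zeta> ^ m i - 1) * z $ i" by (simp add: algebra_simps)
    then show "norm ((weighted_scale m \<zeta> z - z) $ i) \<le> norm (((N * norm (\<zeta> - 1)) *\<^sub>R z) $ i)"
      using mult_right_mono[OF *, of "norm (z $ i)" i] by (simp add: norm_mult)
  qed
  then show ?thesis by simp
qed

section \<open>Averaging over the rotations\<close>

definition unit_circle :: "real \<Rightarrow> complex" where
  "unit_circle t = exp (\<i> * of_real (2 * pi * t))"

lemma norm_unit_circle [simp]: "norm (unit_circle t) = 1"
  unfolding unit_circle_def by (rule norm_exp_i_times)

lemma unit_circle_nonzero [simp]: "unit_circle t \<noteq> 0"
  by (simp add: unit_circle_def)

lemma norm_unit_circle_minus_one_le: "0 \<le> t \<Longrightarrow> norm (unit_circle t - 1) \<le> 2 * pi * t"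
  unfolding unit_circle_def dist_exp_i_1
  using abs_sin_x_le_abs_x[of "2 * pi * t / 2"] by simp

text \<open>Cauchy's formula for the \<open>n\<close>-th derivative, with the circle run through
  once over \<open>{0..1}\<close>: the velocity \<open>2 * pi * \<i> * unit_circle t\<close> cancels
  one of the \<open>Suc n\<close> powers in the denominator.\<close>

lemma has_integral_circle_Taylor_coefficient:
  assumes "\<phi> holomorphic_on cball 0 1"
  shows "((\<lambda>t. inverse (unit_circle t) ^ n * \<phi> (unit_circle t))
           has_integral (deriv ^^ n) \<phi> 0 / fact n) {0..1}"
proof -
  have "((\<lambda>z. \<phi> z / (z - 0) ^ Suc n) has_contour_integral
      (2 * pi * \<i>) / fact n * (deriv ^^ n) \<phi> 0) (circlepath 0 1)"
    using assms
    by (intro Cauchy_has_contour_integral_higher_derivative_circlepath)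
       (auto intro: holomorphic_on_imp_continuous_on holomorphic_on_subset)
  then have "((\<lambda>t. \<phi> (unit_circle t) / unit_circle t ^ Suc n * (2 * pi * \<i> * unit_circle t))
      has_integral (2 * pi * \<i>) / fact n * (deriv ^^ n) \<phi> 0) {0..1}"
    unfolding has_contour_integral_def
    by (rule has_integral_eq[rotated])
       (simp add: vector_derivative_circlepath01, simp add: circlepath unit_circle_def mult_ac)
  from has_integral_mult_right[OF this, of "1 / (2 * pi * \<i>)"]
  show ?thesis
    by (simp add: field_simps power_inverse)
qed

text \<open>Component \<open>l\<close> of the average is the Taylor coefficient of order
  \<open>m l\<close> of \<open>u\<close> along a weighted orbit. Since \<open>u\<close> vanishes to
  second order and scaling shrinks points by \<zeta> to the power \<mu>, this function of \<zeta>
  vanishes to order at least \<open>2 * \<mu>\<close>, which exceeds \<open>m l\<close>. This is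
  where the restriction on the weights enters.\<close>

lemma has_integral_rotation_average_zero:
  fixes u :: "complex^'n \<Rightarrow> complex^'n" and M :: real
  assumes hol: "holomorphic_map_on u D" and sub: "cball 0 (2 * s) \<subseteq> D" and "0 < s"
    and bd: "\<And>x. x \<in> D \<Longrightarrow> norm (u x) \<le> M"
    and u0: "u 0 = 0" and der: "(u has_derivative (\<lambda>_. 0)) (at 0)"
    and weights: "\<And>i. \<mu> \<le> m i" "\<And>i. m i < 2 * \<mu>"
    and w: "norm w \<le> s"
  shows "((\<lambda>t. weighted_scale m (inverse (unit_circle t)) (u (weighted_scale m (unit_circle t) w)))
           has_integral 0) {0..1}"
proof (rule has_integral_vec)
  fix l
  define \<phi> where "\<phi> = (\<lambda>\<zeta>. u (weighted_scale m \<zeta> w) $ l)"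
  define n where "n = m l"
  have small: "norm (weighted_scale m \<zeta> w) \<le> s" if "norm \<zeta> \<le> 1" for \<zeta>
  proof -
    \<comment> \<open>The exponent 0 gives plain non-expansion on the closed unit disc.\<close>
    have "norm (weighted_scale m \<zeta> w) \<le> norm \<zeta> ^ 0 * norm w"
      using that by (intro norm_weighted_scale_le) auto
    then show ?thesis using w by simp
  qed
  have hol\<phi>: "\<phi> holomorphic_on cball 0 1"
  proof -
    have "\<phi> field_differentiable (at \<zeta>)" if \<zeta>: "norm \<zeta> \<le> 1" for \<zeta>
    proof -
      have "weighted_scale m \<zeta> w \<in> D"
        using small[OF \<zeta>] sub \<open>0 < s\<close> by force
      then obtain u' where "(u has_derivative u') (at (weighted_scale m \<zeta> w))" "complex_linear u'"
        using hol unfolding holomorphic_map_on_def by blast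
      from has_field_derivative_holomorphic_curve
        [of u u' "\<lambda>\<zeta>. weighted_scale m \<zeta> w" \<zeta> "\<chi> i. of_nat (m i) * \<zeta> ^ (m i - 1) * w $ i" l, OF this]
      show ?thesis
        unfolding \<phi>_def field_differentiable_def
        by (force intro!: derivative_eq_intros)
    qed
    then show ?thesis
      by (auto simp: holomorphic_on_def intro: field_differentiable_at_within)
  qed
  define C where "C = fact n * (2 * M / s\<^sup>2 * s\<^sup>2)"
  have "0 \<le> M" using bd[of 0] sub \<open>0 < s\<close> u0 by force
  then have "0 \<le> C" by (simp add: C_def)
  \<comment> \<open>Cauchy's inequality on the circle of radius \<epsilon> leaves the power
    \<open>2 * \<mu> - n\<close>, which is at least 1; so the coefficient vanishes as \<epsilon>
    tends to 0.\<close>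
  have est: "norm ((deriv ^^ n) \<phi> 0) \<le> C * \<epsilon>" if \<epsilon>: "0 < \<epsilon>" "\<epsilon> < 1" for \<epsilon>
  proof -
    have "norm ((deriv ^^ n) \<phi> 0) \<le> fact n * (2 * M / s\<^sup>2 * (\<epsilon> ^ \<mu> * s)\<^sup>2) / \<epsilon> ^ n"
    proof (rule Cauchy_inequality)
      show "\<phi> holomorphic_on ball 0 \<epsilon>" "continuous_on (cball 0 \<epsilon>) \<phi>"
        using hol\<phi> \<epsilon> 
        by (auto intro!: holomorphic_on_imp_continuous_on intro: holomorphic_on_subset)
      show "norm (\<phi> \<zeta>) \<le> 2 * M / s\<^sup>2 * (\<epsilon> ^ \<mu> * s)\<^sup>2" if "norm (0 - \<zeta>) = \<epsilon>" for \<zeta>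
      proof -
        have "norm \<zeta> \<le> 1" using that \<epsilon> by simp
        have "norm (weighted_scale m \<zeta> w) \<le> \<epsilon> ^ \<mu> * norm w"
          using norm_weighted_scale_le[OF \<open>norm \<zeta> \<le> 1\<close> weights(1)] that by simp
        also have "\<dots> \<le> \<epsilon> ^ \<mu> * s"
          using w \<epsilon> by (intro mult_left_mono) auto
        finally have le: "norm (weighted_scale m \<zeta> w) \<le> \<epsilon> ^ \<mu> * s" .
        have "norm (\<phi> \<zeta>) \<le> 2 * M / s\<^sup>2 * (norm (weighted_scale m \<zeta> w))\<^sup>2"
          unfolding \<phi>_def
          by (rule Cauchy_quadratic_bound[OF hol sub \<open>0 < s\<close> bd u0 der small[OF \<open>norm \<zeta> \<le> 1\<close>]])
        also have "\<dots> \<le> 2 * M / s\<^sup>2 * (\<epsilon> ^ \<mu> * s)\<^sup>2"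
          using le \<open>0 \<le> M\<close> by (intro mult_left_mono power_mono) auto
        finally show ?thesis .
      qed
    qed (fact \<epsilon>)
    also have "\<dots> = C * (\<epsilon> ^ (2 * \<mu>) / \<epsilon> ^ n)"
      by (simp add: C_def power_mult_distrib power_mult mult.commute[of 2])
    also have "\<epsilon> ^ (2 * \<mu>) / \<epsilon> ^ n = \<epsilon> ^ (2 * \<mu> - n)"
      using weights(2)[of l] \<epsilon> by (simp add: n_def power_diff)
    also have "C * \<epsilon> ^ (2 * \<mu> - n) \<le> C * \<epsilon> ^ 1"
      using weights(2)[of l] \<epsilon> \<open>0 \<le> C\<close>
      by (intro mult_left_mono power_decreasing) (auto simp: n_def)
    finally show ?thesis by simp
  qed
  have "norm ((deriv ^^ n) \<phi> 0) \<le> 0"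
  proof (rule tendsto_lowerbound)
    show "((\<lambda>\<epsilon>. C * \<epsilon>) \<longlongrightarrow> 0) (at_right 0)"
      by (auto intro!: tendsto_eq_intros)
    show "\<forall>\<^sub>F \<epsilon> in at_right 0. norm ((deriv ^^ n) \<phi> 0) \<le> C * \<epsilon>"
      using est by (auto simp: eventually_at_right_field intro!: exI[of _ 1])
  qed simp
  then show "((\<lambda>t. weighted_scale m (inverse (unit_circle t))
      (u (weighted_scale m (unit_circle t) w)) $ l) has_integral 0 $ l) {0..1}"
    using has_integral_circle_Taylor_coefficient[OF hol\<phi>, of n] by (simp add: \<phi>_def n_def)
qed

text \<open>The integrand is at most \<open>R / 2\<close> on \<open>{0..\<eta>}\<close> and at most
  \<open>R\<close> on the rest, so the trivial bound \<open>R\<close> is beaten by the fixed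
  fraction \<open>\<eta> / 2\<close>.\<close>

lemma norm_integral_Lipschitz_bound:
  fixes q :: "real \<Rightarrow> 'a::euclidean_space"
  assumes int: "(q has_integral I) {0..1}"
    and bound: "\<And>t. t \<in> {0..1} \<Longrightarrow> norm (q t) \<le> R"
    and Lipschitz: "\<And>t. t \<in> {0..1} \<Longrightarrow> norm (q t) \<le> L * t"
    and \<eta>: "0 \<le> \<eta>" "\<eta> \<le> 1" "L * \<eta> \<le> R / 2" and "0 \<le> L" 
  shows "norm I \<le> R * (1 - \<eta> / 2)"
proof -
  have "0 \<le> R" using order_trans[OF norm_ge_zero bound[of 0]] by simp
  have "q integrable_on {0..\<eta>}" "q integrable_on {\<eta>..1}"
    using integrable_subinterval_real[OF has_integral_integrable[OF int]] \<eta> by auto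
  then obtain I1 I2 where I: "(q has_integral I1) {0..\<eta>}" "(q has_integral I2) {\<eta>..1}"
    by (auto simp: integrable_on_def)
  then have "I = I1 + I2"
    using has_integral_combine[OF \<eta>(1,2) I] int has_integral_unique by blast
  moreover have "norm I1 \<le> (R / 2) * measure lborel (cbox 0 \<eta>)"
  proof (rule has_integral_bound)
    show "norm (q t) \<le> R / 2" if "t \<in> cbox 0 \<eta>" for t
    proof -
      have "L * t \<le> L * \<eta>" using that \<open>0 \<le> L\<close> by (intro mult_left_mono) auto
      then show ?thesis using Lipschitz[of t] that \<eta> by auto
    qed
  qed (use I \<open>0 \<le> R\<close> in auto)
  moreover have "norm I2 \<le> R * measure lborel (cbox \<eta> 1)"
    by (rule has_integral_bound[OF \<open>0 \<le> R\<close>, of q]) (use I bound \<eta> in auto)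
  moreover have "norm (I1 + I2) \<le> norm I1 + norm I2" by (rule norm_triangle_ineq)
  ultimately show ?thesis using \<eta> by (simp add: algebra_simps)
qed

section \<open>Identity theorem\<close>

text \<open>The interior of the zero set is open and closed in \<open>D\<close>. For closedness, a
  limit point has a ball in \<open>D\<close> that meets this interior at some \<open>b\<close>;
  one-variable continuation along the complex lines through \<open>b\<close> gives zeros on the
  whole ball.\<close>

lemma holomorphic_map_vanishing_connected:
  fixes u :: "complex^'n \<Rightarrow> complex^'m"
  assumes hol: "holomorphic_map_on u D" and D: "open D" "connected D"
    and U: "open U" "U \<subseteq> D" "U \<noteq> {}" "\<And>x. x \<in> U \<Longrightarrow> u x = 0"
    and z: "z \<in> D"
  shows "u z = 0"
proof -
  define Z where "Z = interior {x \<in> D. u x = 0}"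
  have sub: "Z \<subseteq> {x \<in> D. u x = 0}" unfolding Z_def by (rule interior_subset)
  have "open Z" unfolding Z_def by (rule open_interior)
  have "Z \<subseteq> D" using sub by blast
  have "U \<subseteq> Z" unfolding Z_def by (rule interior_maximal) (use U in auto)
  have Z0: "u x = 0" if "x \<in> Z" for x
    using that sub by blast
  have closed: "a \<in> Z" if a: "a \<in> D" "a \<in> closure Z" for a
  proof -
    obtain e where e: "0 < e" "ball a e \<subseteq> D" using D(1) a(1) by (rule openE)
    obtain b where "b \<in> Z" "dist b a < e"
      using a(2) e(1) unfolding closure_approachable by blast
    then have b: "b \<in> Z" "b \<in> ball a e" by (simp_all add: dist_commute)
    have "u x = 0" if x: "x \<in> ball a e" for x
    proof -
      \<comment> \<open>\<open>T\<close> and \<open>W\<close> are the parameters whose points lie in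
        the ball and in \<open>Z\<close>. Parameter 0 gives \<open>b\<close> and parameter 1 gives
        \<open>x\<close>; the vanishing spreads from \<open>W \<inter> T\<close> to the convex set
        \<open>T\<close>.\<close>
      define T where "T = {\<zeta>. b + \<zeta> *s (x - b) \<in> ball a e}"
      define W where "W = {\<zeta>. b + \<zeta> *s (x - b) \<in> Z}"
      have cont: "continuous_on UNIV (\<lambda>\<zeta>. b + \<zeta> *s (x - b))"
        unfolding continuous_on_def
        by (intro ballI vec_tendstoI) (simp, intro tendsto_intros)
      have "open T" "open W"
        using open_vimage[OF open_ball cont] open_vimage[OF \<open>open Z\<close> cont]
        by (simp_all add: T_def W_def vimage_def)
      have "convex T"
      proof (rule convexI)
        fix \<zeta> \<eta> :: complex and \<alpha> \<beta> :: real
        assume h: "\<zeta> \<in> T" "\<eta> \<in> T" "0 \<le> \<alpha>" "0 \<le> \<beta>" "\<alpha> + \<beta> = 1"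
        have "\<alpha> *\<^sub>R (b + \<zeta> *s (x - b)) + \<beta> *\<^sub>R (b + \<eta> *s (x - b)) \<in> ball a e"
          using convexD[OF convex_ball] h unfolding T_def by blast
        also have "\<alpha> *\<^sub>R (b + \<zeta> *s (x - b)) + \<beta> *\<^sub>R (b + \<eta> *s (x - b))
            = (\<alpha> + \<beta>) *\<^sub>R b + (\<alpha> *\<^sub>R \<zeta> + \<beta> *\<^sub>R \<eta>) *s (x - b)"
          by (simp add: vec_eq_iff algebra_simps)
        finally show "\<alpha> *\<^sub>R \<zeta> + \<beta> *\<^sub>R \<eta> \<in> T" using h(5) by (simp add: T_def)
      qed
      have "u (b + 1 *s (x - b)) $ l = 0" for l
      proof (rule analytic_continuation_open[of "W \<inter> T" T "\<lambda>\<zeta>. u (b + \<zeta> *s (x - b)) $ l" "\<lambda>_. 0"])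
        have "0 \<in> W \<inter> T" using b by (simp add: W_def T_def)
        then show "W \<inter> T \<noteq> {}" by blast
        show "(\<lambda>\<zeta>. u (b + \<zeta> *s (x - b)) $ l) holomorphic_on T"
          using e by (intro holomorphic_on_line[OF hol]) (auto simp: T_def)
        show "1 \<in> T" using x by (simp add: T_def)
        show "connected T" using \<open>convex T\<close> by (rule convex_connected)
      qed (use \<open>open T\<close> \<open>open W\<close> Z0 in \<open>auto simp: W_def\<close>)
      then show "u x = 0" by (simp add: vec_eq_iff)
    qed
    then have "ball a e \<subseteq> Z" unfolding Z_def using e by (intro interior_maximal) auto
    then show "a \<in> Z" using e by auto
  qed
  have "openin (top_of_set D) Z" using \<open>open Z\<close> \<open>Z \<subseteq> D\<close> by (rule open_openin_trans[OF D(1)])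
  moreover have "closedin (top_of_set D) Z"
  proof -
    have "Z = D \<inter> closure Z" using closed \<open>Z \<subseteq> D\<close> closure_subset by blast
    then show ?thesis by (metis closed_closure closedin_closed_Int)
  qed
  ultimately have "Z = D"
    using D(2) U(3) \<open>U \<subseteq> Z\<close> unfolding connected_clopen by blast
  then show ?thesis using z Z0 by blast
qed

section \<open>Automorphisms fixing the origin\<close>

lemma holomorphic_map_on_compose:
  assumes "holomorphic_map_on g D" "holomorphic_map_on h E" "g ` D \<subseteq> E"
  shows "holomorphic_map_on (h \<circ> g) D"
  unfolding holomorphic_map_on_def
proof
  fix z assume z: "z \<in> D"
  then obtain g' h' where "(g has_derivative g') (at z)" "complex_linear g'"
      "(h has_derivative h') (at (g z))" "complex_linear h'"
    using assms unfolding holomorphic_map_on_def by (meson image_subset_iff)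
  then show "\<exists>f'. (h \<circ> g has_derivative f') (at z) \<and> complex_linear f'"
    by (intro exI[of _ "h' \<circ> g'"] conjI diff_chain_at Vector_Spaces.linear_compose)
qed

lemma holomorphic_map_on_diff:
  assumes "holomorphic_map_on g D" "holomorphic_map_on h D"
  shows "holomorphic_map_on (\<lambda>z. g z - h z) D"
  unfolding holomorphic_map_on_def
proof
  fix z assume "z \<in> D"
  then obtain g' h' where "(g has_derivative g') (at z)" "complex_linear g'"
      "(h has_derivative h') (at z)" "complex_linear h'"
    using assms unfolding holomorphic_map_on_def by meson
  then show "\<exists>f'. ((\<lambda>z. g z - h z) has_derivative f') (at z) \<and> complex_linear f'"
    by (intro exI[of _ "\<lambda>v. g' v - h' v"] conjI has_derivative_diff)
       (simp_all add: Vector_Spaces.linear_iff algebra_simps)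
qed

lemma holomorphic_map_on_linear:
  assumes "complex_linear L" "bounded_linear L"
  shows "holomorphic_map_on L D"
  using assms unfolding holomorphic_map_on_def by (blast intro: bounded_linear_imp_has_derivative)

text \<open>The inverse \<open>k\<close> and both derivatives at 0 are carried along explicitly, so
  that inverses and conjugates come with their derivatives. Complex linearity of \<open>A\<close>
  and \<open>B\<close> is not stored; it follows from uniqueness of derivatives.\<close>

definition origin_automorphism ::
    "(complex^'n) set \<Rightarrow> (complex^'n \<Rightarrow> complex^'n) \<Rightarrow> (complex^'n \<Rightarrow> complex^'n) \<Rightarrow>
     (complex^'n \<Rightarrow> complex^'n) \<Rightarrow> (complex^'n \<Rightarrow> complex^'n) \<Rightarrow> bool" where
  "origin_automorphism D g k A B \<longleftrightarrow>
     holomorphic_map_on g D \<and> holomorphic_map_on k D \<and> g ` D \<subseteq> D \<and> k ` D \<subseteq> D \<and>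
     (\<forall>z\<in>D. k (g z) = z \<and> g (k z) = z) \<and> g 0 = 0 \<and> k 0 = 0 \<and>
     (g has_derivative A) (at 0) \<and> (k has_derivative B) (at 0)"

lemma origin_automorphism_inverse:
  "origin_automorphism D g k A B \<Longrightarrow> origin_automorphism D k g B A"
  by (auto simp: origin_automorphism_def)

lemma origin_automorphism_compose:
  assumes "origin_automorphism D g k A B" "origin_automorphism D g' k' A' B'"
  shows "origin_automorphism D (g' \<circ> g) (k \<circ> k') (A' \<circ> A) (B \<circ> B')"
  using assms unfolding origin_automorphism_def
  by (auto intro!: holomorphic_map_on_compose diff_chain_at simp: image_subset_iff)

lemma origin_automorphism_complex_linear:
  assumes "origin_automorphism D g k A B" "0 \<in> D"
  shows "complex_linear A"
  using assms unfolding origin_automorphism_def holomorphic_map_on_def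
  by (metis has_derivative_unique)

lemma origin_automorphism_derivative_inverse:
  assumes aut: "origin_automorphism D g k A B" and D: "open D" "0 \<in> D"
  shows "B (A v) = v"
proof -
  have "(k \<circ> g has_derivative B \<circ> A) (at 0)"
    using aut by (intro diff_chain_at) (auto simp: origin_automorphism_def)
  moreover have "(k \<circ> g has_derivative id) (at 0)"
    by (rule has_derivative_transform_within_open[OF has_derivative_id D])
       (use aut in \<open>auto simp: origin_automorphism_def\<close>)
  ultimately have "B \<circ> A = id" by (rule has_derivative_unique)
  then show ?thesis by (metis comp_apply id_apply)
qed

lemma origin_automorphism_weighted_scale:
  assumes "\<And>\<zeta> z. norm \<zeta> = 1 \<Longrightarrow> z \<in> D \<Longrightarrow> weighted_scale m \<zeta> z \<in> D" and "norm \<zeta> = 1"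
  shows "origin_automorphism D (weighted_scale m \<zeta>) (weighted_scale m (inverse \<zeta>))
           (weighted_scale m \<zeta>) (weighted_scale m (inverse \<zeta>))"
proof -
  have "\<zeta> \<noteq> 0" "norm (inverse \<zeta>) = 1" using assms(2) by (auto simp: norm_inverse)
  then show ?thesis
    using assms unfolding origin_automorphism_def
    by (auto intro: holomorphic_map_on_linear complex_linear_weighted_scale
        bounded_linear_weighted_scale bounded_linear_imp_has_derivative)
qed

section \<open>The contraction argument for the supremum\<close>

text \<open>Weights in the range from \<mu> to below \<open>2 * \<mu>\<close> are never sums of two
  or more weights, in any dimension.\<close>

theorem origin_automorphism_linear:
  fixes D :: "(complex^'n) set"
  assumes D: "open D" "connected D" "bounded D" "0 \<in> D"
    and rot: "\<And>\<zeta> z. norm \<zeta> = 1 \<Longrightarrow> z \<in> D \<Longrightarrow> weighted_scale m \<zeta> z \<in> D"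
    and weights: "\<And>i. \<mu> \<le> m i" "\<And>i. m i < 2 * \<mu>"
    and aut: "origin_automorphism D g k A B" and z: "z \<in> D"
  shows "g z = A z"
proof -
  obtain M where M: "\<And>x. x \<in> D \<Longrightarrow> norm x \<le> M"
    using D(3) unfolding bounded_iff by auto
  have "0 \<le> M" using M[OF D(4)] by simp
  obtain e where e: "0 < e" "cball 0 e \<subseteq> D"
    using D open_contains_cball by blast
  define s where "s = e / 2"
  have s: "0 < s" "cball 0 (2 * s) \<subseteq> D" using e by (simp_all add: s_def)
  have "cball 0 s \<subseteq> D" using s by force
  \<comment> \<open>One Cauchy constant for every automorphism: it bounds both the Lipschitz
    constant on \<open>cball 0 s\<close> and the derivative at 0.\<close>
  define K where "K = CARD('n) * M / s"
  have "0 \<le> K" using s \<open>0 \<le> M\<close> by (simp add: K_def)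
  have Lip: "norm (g x - g y) \<le> K * norm (x - y)"
    if "origin_automorphism D g k A B" "norm x \<le> s" "norm y \<le> s" for g k A B x y
    unfolding K_def by (rule Cauchy_Lipschitz_bound[OF _ s(2,1)])
      (use that M in \<open>auto simp: origin_automorphism_def\<close>)
  have deriv_bound: "norm (A v) \<le> K * norm v" if "origin_automorphism D g k A B" for g k A B v
    unfolding K_def
    by (rule Cauchy_derivative_bound[OF _ \<open>cball 0 s \<subseteq> D\<close> s(1) _ _
          origin_automorphism_complex_linear[OF that D(4)], of g])
      (use that M in \<open>auto simp: origin_automorphism_def\<close>)
  \<comment> \<open>Chosen so that every automorphism maps \<open>cball 0 r\<close> into
    \<open>cball 0 s\<close>, where the Lipschitz bound and the averaging lemma are
    available.\<close>
  define r where "r = s / (K + 1)"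
  have r: "0 < r" "r \<le> s" "K * r \<le> s"
    using s \<open>0 \<le> K\<close> by (simp_all add: r_def field_simps)
  have rD: "x \<in> D" if "norm x \<le> r" for x using that r \<open>cball 0 s \<subseteq> D\<close> by auto
  define N where "N = (\<Sum>i\<in>UNIV. m i)"
  have N: "m i \<le> N" for i unfolding N_def by (rule member_le_sum) auto
  define c where "c = N * (2 * pi)"
  have "0 \<le> c" by (simp add: c_def)
  \<comment> \<open>The outer \<open>K\<close> comes from \<open>B\<close>, the first summand from
    rotating the argument of \<open>A \<circ> k\<close>, and the second from rotating its value
    back; \<open>c\<close> bounds the speed of the rotations.\<close>
  define L where "L = K * (K * K * c * s + c * K * s)"
  have "0 \<le> L" using \<open>0 \<le> K\<close> \<open>0 \<le> c\<close> s by (simp add: L_def)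
  define S where "S = {norm (B (g x) - x) | g k A B x. origin_automorphism D g k A B \<and> norm x \<le> r}"
  define R where "R = Sup S"
  have "bdd_above S"
  proof (rule bdd_aboveI)
    fix y assume "y \<in> S"
    then obtain g k A B x where y: "y = norm (B (g x) - x)"
        and aut: "origin_automorphism D g k A B" and x: "norm x \<le> r"
      by (auto simp: S_def)
    have "g x \<in> D" using aut rD[OF x] by (auto simp: origin_automorphism_def)
    then have "norm (B (g x)) \<le> K * M"
      using deriv_bound[OF origin_automorphism_inverse[OF aut], of "g x"] M \<open>0 \<le> K\<close>
      by (meson mult_left_mono order_trans)
    then show "y \<le> K * M + r"
      unfolding y using norm_triangle_ineq4[of "B (g x)" x] x by linarith
  qed
  have in_R: "norm (B (g x) - x) \<le> R"
    if "origin_automorphism D g k A B" "norm x \<le> r" for g k A B x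
  proof -
    have "norm (B (g x) - x) \<in> S" using that unfolding S_def by blast
    then show ?thesis unfolding R_def using \<open>bdd_above S\<close> by (rule cSup_upper)
  qed
  have "0 \<le> R" using order_trans[OF norm_ge_zero in_R[OF aut, of 0]] r by simp
  have improve: "norm (B (g x) - x) \<le> R * (1 - \<eta> / 2)"
    if aut: "origin_automorphism D g k A B" and x: "norm x \<le> r"
      and \<eta>: "0 \<le> \<eta>" "\<eta> \<le> 1" "L * \<eta> \<le> R / 2" for g k A B x \<eta>
  proof -
    note inv = origin_automorphism_inverse[OF aut]
    note BA = origin_automorphism_derivative_inverse[OF aut D(1,4)]
    note AB = origin_automorphism_derivative_inverse[OF inv D(1,4)]
    have blA: "bounded_linear A" and blB: "bounded_linear B"
      using aut by (auto simp: origin_automorphism_def intro: has_derivative_bounded_linear)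
    define w where "w = g x"
    have "k w = x" using aut rD[OF x] by (simp add: w_def origin_automorphism_def)
    have w: "norm w \<le> s"
    proof -
      have "norm w \<le> K * norm x"
        using Lip[OF aut, of x 0] aut x r s by (simp add: w_def origin_automorphism_def)
      also have "\<dots> \<le> K * r" using x \<open>0 \<le> K\<close> by (rule mult_left_mono)
      finally show ?thesis using r by simp
    qed
    define \<rho> where "\<rho> = (\<lambda>t. weighted_scale m (unit_circle t))"
    define \<rho>' where "\<rho>' = (\<lambda>t. weighted_scale m (inverse (unit_circle t)))"
    \<comment> \<open>Because \<open>A\<close> inverts \<open>B\<close>, this map has zero value and
      zero derivative at 0, so its rotation average vanishes.\<close>
    define u where "u = (\<lambda>y. A (k y) - y)"
    have "((\<lambda>t. \<rho>' t (u (\<rho> t w))) has_integral 0) {0..1}"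
      unfolding \<rho>_def \<rho>'_def
    proof (rule has_integral_rotation_average_zero[OF _ s(2,1) _ _ _ weights w])
      have "holomorphic_map_on (A \<circ> k) D"
        using aut blA origin_automorphism_complex_linear[OF aut D(4)]
        by (intro holomorphic_map_on_compose[OF _ holomorphic_map_on_linear])
           (auto simp: origin_automorphism_def)
      moreover have "holomorphic_map_on (\<lambda>y. y) D"
        by (rule holomorphic_map_on_linear[OF vec.linear_ident bounded_linear_ident])
      ultimately show "holomorphic_map_on u D"
        unfolding u_def using holomorphic_map_on_diff by fastforce
      show "norm (u y) \<le> K * M + M" if "y \<in> D" for y
      proof -
        have "k y \<in> D" using that aut by (auto simp: origin_automorphism_def)
        then have "norm (A (k y)) \<le> K * M"
          using deriv_bound[OF aut, of "k y"] M \<open>0 \<le> K\<close> by (meson mult_left_mono order_trans)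
        then show ?thesis
          unfolding u_def using norm_triangle_ineq4[of "A (k y)" y] M[OF that] by linarith
      qed
      show "u 0 = 0"
        using aut bounded_linear.linear[OF blA, THEN linear_0] by (simp add: u_def origin_automorphism_def)
      have "(k has_derivative B) (at 0)" using aut by (simp add: origin_automorphism_def)
      from has_derivative_diff[OF bounded_linear.has_derivative[OF blA this] has_derivative_ident]
      show "(u has_derivative (\<lambda>_. 0)) (at 0)" by (simp add: u_def AB)
    qed
    moreover have "\<rho>' t (u (\<rho> t w)) = \<rho>' t (A (k (\<rho> t w))) - w" for t
      by (simp add: u_def weighted_scale_diff \<rho>_def \<rho>'_def)
    \<comment> \<open>Adding \<open>w\<close> back shows that
      \<open>\<rho>' t (A (k (\<rho> t w)))\<close> has average \<open>w\<close>; applying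
      \<open>B\<close> and subtracting \<open>x\<close> then represents \<open>B (g x) - x\<close>
      as an average.\<close>
    ultimately have "((\<lambda>t. \<rho>' t (A (k (\<rho> t w))) - w + w) has_integral 0 + w) {0..1}"
      using has_integral_const_real[of w 0 1] by (intro has_integral_add) auto
    from has_integral_linear[OF this blB] has_integral_const_real[of x 0 1]
    have int: "((\<lambda>t. B (\<rho>' t (A (k (\<rho> t w)))) - x) has_integral B w - x) {0..1}"
      by (intro has_integral_diff) (auto simp: o_def)
    have "norm (B w - x) \<le> R * (1 - \<eta> / 2)"
    proof (rule norm_integral_Lipschitz_bound[OF int _ _ \<eta> \<open>0 \<le> L\<close>])
      fix t :: real assume t: "t \<in> {0..1}"
      \<comment> \<open>The integrand is the quantity measured by \<open>R\<close>, taken for the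
        conjugate of \<open>\<rho> t\<close> by \<open>g\<close>, so it is bounded by
        \<open>R\<close>.\<close>
      have "origin_automorphism D (k \<circ> (\<rho> t \<circ> g)) ((k \<circ> \<rho>' t) \<circ> g) (B \<circ> (\<rho> t \<circ> A)) ((B \<circ> \<rho>' t) \<circ> A)"
        unfolding \<rho>_def \<rho>'_def
        by (intro origin_automorphism_compose[OF origin_automorphism_compose[OF aut] inv]
            origin_automorphism_weighted_scale rot norm_unit_circle)
      from in_R[OF this x] show "norm (B (\<rho>' t (A (k (\<rho> t w)))) - x) \<le> R"
        by (simp add: w_def)
      \<comment> \<open>For the bound linear in \<open>t\<close>, compare with \<open>t = 0\<close>:
        \<open>Y\<close> equals \<open>A x\<close>, so \<open>B Y = x\<close>. As rotations are
        isometries, it suffices to estimate \<open>X - \<rho> t Y\<close>.\<close>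
      define X Y where "X = A (k (\<rho> t w))" and "Y = A (k w)"
      have \<rho>_diff: "norm (\<rho> t y - y) \<le> c * t * norm y" for y
      proof -
        have "norm (\<rho> t y - y) \<le> N * norm (unit_circle t - 1) * norm y"
          unfolding \<rho>_def by (rule norm_weighted_scale_diff_le) (use N in auto)
        also have "\<dots> \<le> N * (2 * pi * t) * norm y"
          using norm_unit_circle_minus_one_le[of t] t by (intro mult_right_mono mult_left_mono) auto
        finally show ?thesis by (simp add: c_def mult_ac)
      qed
      have XY: "norm (X - Y) \<le> K * (K * (c * t * s))"
      proof -
        have "X - Y = A (k (\<rho> t w) - k w)"
          unfolding X_def Y_def by (rule linear_diff[OF bounded_linear.linear[OF blA], symmetric])
        then have "norm (X - Y) \<le> K * norm (k (\<rho> t w) - k w)"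
          using deriv_bound[OF aut] by simp
        also have "\<dots> \<le> K * (K * norm (\<rho> t w - w))"
          using Lip[OF inv, of "\<rho> t w" w] w \<open>0 \<le> K\<close>
          by (intro mult_left_mono) (auto simp: \<rho>_def)
        also have "\<dots> \<le> K * (K * (c * t * norm w))"
          using \<rho>_diff \<open>0 \<le> K\<close> by (intro mult_left_mono) auto
        also have "\<dots> \<le> K * (K * (c * t * s))"
          using w t \<open>0 \<le> K\<close> \<open>0 \<le> c\<close> by (intro mult_left_mono) auto
        finally show ?thesis .
      qed
      have Y: "norm Y \<le> K * s"
      proof -
        have "norm Y \<le> K * norm x" unfolding Y_def \<open>k w = x\<close> by (rule deriv_bound[OF aut])
        also have "\<dots> \<le> K * s" using x r \<open>0 \<le> K\<close> by (intro mult_left_mono) auto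
        finally show ?thesis .
      qed
      have "norm (\<rho> t Y - Y) \<le> c * t * (K * s)"
        using \<rho>_diff[of Y] Y t \<open>0 \<le> c\<close> by (meson atLeastAtMost_iff mult_left_mono mult_nonneg_nonneg order_trans)
      then have X\<rho>Y: "norm (X - \<rho> t Y) \<le> K * (K * (c * t * s)) + c * t * (K * s)"
        using XY norm_triangle_ineq4[of "X - Y" "\<rho> t Y - Y"] by simp
      have "norm (\<rho>' t X - Y) = norm (X - \<rho> t Y)"
      proof -
        have "\<rho>' t X - Y = \<rho>' t (X - \<rho> t Y)"
          by (simp add: \<rho>_def \<rho>'_def weighted_scale_diff)
        then show ?thesis by (simp add: \<rho>'_def norm_inverse)
      qed
      moreover have "B (\<rho>' t X) - x = B (\<rho>' t X - Y)"
        using linear_diff[OF bounded_linear.linear[OF blB], of "\<rho>' t X" Y] BA[of x]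
        by (simp add: Y_def \<open>k w = x\<close>)
      ultimately have "norm (B (\<rho>' t X) - x) \<le> K * norm (X - \<rho> t Y)"
        using deriv_bound[OF inv, of "\<rho>' t X - Y"] by simp
      also have "\<dots> \<le> K * (K * (K * (c * t * s)) + c * t * (K * s))"
        using X\<rho>Y \<open>0 \<le> K\<close> by (rule mult_left_mono)
      also have "\<dots> = L * t" by (simp add: L_def algebra_simps)
      finally show "norm (B (\<rho>' t (A (k (\<rho> t w)))) - x) \<le> L * t" by (simp add: X_def)
    qed
    then show ?thesis by (simp add: w_def)
  qed
  have "R = 0"
  proof (rule ccontr)
    assume "R \<noteq> 0"
    then have "0 < R" using \<open>0 \<le> R\<close> by simp
    \<comment> \<open>The \<open>L + 1\<close> avoids division by zero when
      \<open>L = 0\<close>.\<close>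
    define \<eta> where "\<eta> = min 1 (R / (2 * (L + 1)))"
    have \<eta>: "0 < \<eta>" "\<eta> \<le> 1" using \<open>0 < R\<close> \<open>0 \<le> L\<close> by (auto simp: \<eta>_def)
    have "L * \<eta> \<le> L * (R / (2 * (L + 1)))"
      using \<open>0 \<le> L\<close> by (intro mult_left_mono) (auto simp: \<eta>_def)
    also have "\<dots> \<le> R / 2" using \<open>0 < R\<close> \<open>0 \<le> L\<close> by (simp add: field_simps)
    finally have "L * \<eta> \<le> R / 2" .
    then have "y \<le> R * (1 - \<eta> / 2)" if "y \<in> S" for y
      using improve \<eta> that by (auto simp: S_def)
    moreover have "norm (B (g 0) - 0) \<in> S"
      unfolding S_def using aut r(1) by (intro CollectI exI[of _ g] exI[of _ k] exI[of _ A] exI[of _ B] exI[of _ 0]) simp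
    then have "S \<noteq> {}" by blast
    ultimately have "R \<le> R * (1 - \<eta> / 2)"
      unfolding R_def by (metis cSup_least)
    then show False using mult_pos_pos[OF \<open>0 < R\<close> \<eta>(1)] by (simp add: algebra_simps)
  qed
  \<comment> \<open>\<open>R = 0\<close> gives \<open>B (g x) = x\<close> near the origin; applying
    \<open>A\<close> yields linearity there, and the identity theorem carries it to
    \<open>D\<close>.\<close>
  have zero: "g x - A x = 0" if x: "x \<in> ball 0 r" for x
  proof -
    have "B (g x) = x" using in_R[OF aut, of x] x \<open>R = 0\<close> by simp
    moreover have "A (B (g x)) = g x"
      by (rule origin_automorphism_derivative_inverse[OF origin_automorphism_inverse[OF aut] D(1,4)])
    ultimately show ?thesis by simp
  qed
  have "bounded_linear A" and "holomorphic_map_on g D"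
    using aut unfolding origin_automorphism_def by (blast intro: has_derivative_bounded_linear)+
  then have "holomorphic_map_on (\<lambda>x. g x - A x) D"
    using holomorphic_map_on_diff holomorphic_map_on_linear
      origin_automorphism_complex_linear[OF aut D(4)] by blast
  then have "g z - A z = 0"
  proof (rule holomorphic_map_vanishing_connected[OF _ D(1,2) open_ball _ _ zero z])
    show "ball 0 r \<subseteq> D" using rD by (auto simp: less_imp_le)
    show "ball 0 r \<noteq> {}" using r(1) by simp
  qed
  then show ?thesis by simp
qed

section \<open>Specialisation to quasi-circular domains in three variables\<close>

theorem corollary3p5:
  fixes D :: "(complex^3) set" and m1 m2 m3 :: nat and f :: "complex^3 \<Rightarrow> complex^3"
  assumes "quasi_circular_domain m1 m2 m3 D"
    and "bounded D"
    and "0 \<in> D"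
    and "3 \<le> m1" and "m1 < m2" and "m2 < m3" and "m3 < 2 * m1"
    and "holomorphic_automorphism f D"
    and "f 0 = 0"
  shows "\<exists>L :: complex^3 \<Rightarrow> complex^3. complex_linear L \<and> (\<forall>z\<in>D. f z = L z)"
proof -
  define m :: "3 \<Rightarrow> nat" where "m = (($) (vector [m1, m2, m3]))"
  have m: "m 1 = m1" "m 2 = m2" "m 3 = m3" by (simp_all add: m_def)
  have D: "open D" "connected D" and rot: "\<And>\<theta>. weighted_rotation m1 m2 m3 \<theta> ` D = D"
    using assms(1) by (auto simp: quasi_circular_domain_def is_domain_def)
  have scale: "weighted_scale m \<zeta> z \<in> D" if "norm \<zeta> = 1" "z \<in> D" for \<zeta> z
  proof -
    \<comment> \<open>Passing to an angle turns scaling by a unimodular number into one of the given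
      rotations.\<close>
    obtain \<theta> where \<theta>: "\<zeta> = exp (\<i> * of_real \<theta>)"
      using \<open>norm \<zeta> = 1\<close> by (metis complex_norm_eq_1_exp_eq)
    have "weighted_scale m \<zeta> z = weighted_rotation m1 m2 m3 \<theta> z"
      by (simp add: vec_eq_iff forall_3 weighted_rotation_def m \<theta> mult_ac flip: exp_of_nat_mult)
    then show ?thesis using rot[of \<theta>] that(2) by blast
  qed
  define k where "k = inv_into D f"
  have bij: "bij_betw f D D" and hol: "holomorphic_map_on f D" "holomorphic_map_on k D"
    using assms(8) by (auto simp: holomorphic_automorphism_def biholomorphic_map_def k_def)
  have kD: "k ` D = D" and kf: "\<And>z. z \<in> D \<Longrightarrow> k (f z) = z" and fk: "\<And>z. z \<in> D \<Longrightarrow> f (k z) = z"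
    using bij bij_betw_imp_surj_on[OF bij_betw_inv_into[OF bij]]
    by (auto simp: k_def bij_betw_inv_into_left bij_betw_inv_into_right)
  obtain A B where "(f has_derivative A) (at 0)" "(k has_derivative B) (at 0)"
    using hol assms(3) unfolding holomorphic_map_on_def by blast
  then have aut: "origin_automorphism D f k A B"
    using hol bij kD kf fk kf[OF assms(3)] assms(9)
    by (simp add: origin_automorphism_def bij_betw_def)
  \<comment> \<open>Here \<mu> is \<open>m1\<close>: all three weights lie between \<open>m1\<close>
    and \<open>m3\<close>, and \<open>m3 < 2 * m1\<close>.\<close>
  have "f z = A z" if "z \<in> D" for z
  proof (rule origin_automorphism_linear[OF D assms(2,3) scale _ _ aut that])
    show "m1 \<le> m i" "m i < 2 * m1" for i
      using assms(5-7) exhaust_3[of i] by (auto simp: m)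
  qed
  then show ?thesis
    using origin_automorphism_complex_linear[OF aut assms(3)] by blast
qed

end
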